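(* Let $(G,\varphi)$ be a simple game, with $\varphi=\square\bigwedge_{i\in I}\varphi_i$, $\varphi_i=\Diamond p_i\vee\psi_i$, where each $p_i$ is a positional formula and each $\psi_i$ is an absolute liveness formula with $W_G(\psi_i)\subseteq W(\varphi)$. Then the winning set of player $0$ is $$\llbracket\varphi\rrbracket=\nu Z\bigcap_{i\in I}\left\llbracket \psi_i\vee\Diamond(p_i\wedge\bigcirc Z)\right\rrbracket .$$
   Context: LTL: over a set $P$ of atomic propositions, formulas are built from $p\in P$, $\neg$, $\vee$, $\bigcirc$ (next), $\mathcal U$ (until), with the usual semantics $w,i\models\varphi$ over infinite words $w\in\Sigma^\omega$, $\Sigma=2^P$; $w\models\varphi$ means $w,0\models\varphi$. $\wedge$, $\implies$, $\Diamond\varphi=\mathbf{True}\,\mathcal U\,\varphi$, $\square\varphi=\neg\Diamond\neg\varphi$ are the usual abbreviations. $W(\varphi)=\{w\in\Sigma^\omega: w\models\varphi\}$. $\varphi\equiv\psi$ means $W(\varphi)=W(\psi)$. A positional formula is one with no temporal operators. $\varphi$ is an absolute liveness formula if $\Sigma^*W(\varphi)\subseteq W(\varphi)$ (prepending any finite word to a word in $W(\varphi)$ gives a word in $W(\varphi)$). Games: a game graph $G=(V,E,P,L)$ has a finite state set $V=V_0\sqcup V_1$ (player $k$ moves at states of $V_k$), a transition relation $E\subseteq V\times V$ such that every state has at least one successor, a finite set $P$ of atomic propositions and a labeling $L:V\to 2^P$, extended letterwise to infinite sequences. A play is an infinite sequence $v_0v_1\ldots$ with $(v_i,v_{i+1})\in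 E$ for all $i$; $\Omega(G)$ is the set of all plays and $W_G(\varphi)=W(\varphi)\cap L(\Omega(G))$. An LTL game is a pair $(G,\varphi)$ with $\varphi$ an LTL formula (the winning condition). A strategy for player 0 is a partial function $f:V^*\times V_0\to V$ with $(v,f(r,v))\in E$ whenever defined (here $r$ is the past history and $v$ the current state). It is winning from $v$ if it is defined at every player-0 position reached from $v$ while following it and every play $r$ from $v$ following $f$ satisfies $L(r)\in W(\varphi)$. $\llbracket\varphi\rrbracket$ is the set of states from which player 0 has a winning strategy in $(G,\varphi)$. A set of states $Z\subseteq V$ used inside a formula denotes an atomic proposition holding exactly at the states of $Z$ (with $P$ and $L$ extended accordingly). For monotone $F:2^V\to2^V$, $\nu Z\,F(Z)=\bigcap_i Z_i$ with $Z_0=V$, $Z_{i+1}=F(Z_i)$ (the greatest fixed point). Simple game: an LTL game $(G,\varphi)$ whose winning condition can be written (up to $\equiv$) as $\varphi=\square\bigwedge_{i\in I}\varphi_i$, $\varphi_i=\Diamond p_i\vee\psi_i$, with $I$ a finite index set, $p_i$ positional formulas and $\psi_i$ absolute liveness formulas satisfying $W_G(\psi_i)\subseteq W(\varphi)$. *)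

theory Defs
  imports Main "HOL-Library.Omega_Words_Fun"
begin

(* The constant True is a constructor, so that it is available even if there are no propositions. *)
datatype (atoms: 'p) ltl =
    TrueL
  | Atom 'p
  | Neg "'p ltl"
  | Or "'p ltl" "'p ltl"
  | Next "'p ltl"
  | Until "'p ltl" "'p ltl"

abbreviation And :: "'p ltl \<Rightarrow> 'p ltl \<Rightarrow> 'p ltl" where
  "And \<phi> \<psi> \<equiv> Neg (Or (Neg \<phi>) (Neg \<psi>))"

abbreviation Diamond :: "'p ltl \<Rightarrow> 'p ltl" where
  "Diamond \<phi> \<equiv> Until TrueL \<phi>"

abbreviation Box :: "'p ltl \<Rightarrow> 'p ltl" where
  "Box \<phi> \<equiv> Neg (Diamond (Neg \<phi>))"

(* Conjunction over a finite index set, in an arbitrarily chosen order; the order is semantically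
   irrelevant (sat_BigAnd below), and the empty conjunction is True. *)
definition BigAnd :: "'i set \<Rightarrow> ('i \<Rightarrow> 'p ltl) \<Rightarrow> 'p ltl" where
  "BigAnd I \<phi> = foldr And (map \<phi> (SOME is. set is = I \<and> distinct is)) TrueL"

fun sat :: "'p set word \<Rightarrow> nat \<Rightarrow> 'p ltl \<Rightarrow> bool" where
  "sat w i TrueL \<longleftrightarrow> True"
| "sat w i (Atom p) \<longleftrightarrow> p \<in> w i"
| "sat w i (Neg \<phi>) \<longleftrightarrow> \<not> sat w i \<phi>"
| "sat w i (Or \<phi> \<psi>) \<longleftrightarrow> sat w i \<phi> \<or> sat w i \<psi>"
| "sat w i (Next \<phi>) \<longleftrightarrow> sat w (Suc i) \<phi>"
| "sat w i (Until \<phi> \<psi>) \<longleftrightarrow> (\<exists>k\<ge>i. sat w k \<psi> \<and> (\<forall>j. i \<le> j \<and> j < k \<longrightarrow> sat w j \<phi>))"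

lemma sat_BigAnd:
  assumes "finite I"
  shows "sat w j (BigAnd I \<phi>) \<longleftrightarrow> (\<forall>i\<in>I. sat w j (\<phi> i))"
proof -
  define xs where "xs = (SOME is. set is = I \<and> distinct is)"
  have "set xs = I"
    unfolding xs_def using someI_ex[OF finite_distinct_list[OF assms]] by simp
  moreover have "sat w j (foldr And (map \<phi> ys) TrueL) \<longleftrightarrow> (\<forall>i\<in>set ys. sat w j (\<phi> i))" for ys
    by (induction ys) auto
  ultimately show ?thesis
    by (simp add: BigAnd_def flip: xs_def)
qed

definition W :: "'p set \<Rightarrow> 'p ltl \<Rightarrow> 'p set word set" where
  "W P \<phi> = {w. range w \<subseteq> Pow P \<and> sat w 0 \<phi>}"

definition ltl_equiv :: "'p set \<Rightarrow> 'p ltl \<Rightarrow> 'p ltl \<Rightarrow> bool" where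
  "ltl_equiv P \<phi> \<psi> \<longleftrightarrow> W P \<phi> = W P \<psi>"

fun positional :: "'p ltl \<Rightarrow> bool" where
  "positional TrueL \<longleftrightarrow> True"
| "positional (Atom p) \<longleftrightarrow> True"
| "positional (Neg \<phi>) \<longleftrightarrow> positional \<phi>"
| "positional (Or \<phi> \<psi>) \<longleftrightarrow> positional \<phi> \<and> positional \<psi>"
| "positional (Next \<phi>) \<longleftrightarrow> False"
| "positional (Until \<phi> \<psi>) \<longleftrightarrow> False"

definition absolute_liveness :: "'p set \<Rightarrow> 'p ltl \<Rightarrow> bool" where
  "absolute_liveness P \<phi> \<longleftrightarrow> (\<forall>u \<in> lists (Pow P). \<forall>w \<in> W P \<phi>. u \<frown> w \<in> W P \<phi>)"

record ('v, 'p) game_graph =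
  V0 :: "'v set"
  V1 :: "'v set"
  edges :: "('v \<times> 'v) set"
  props :: "'p set"
  label :: "'v \<Rightarrow> 'p set"

definition states :: "('v, 'p) game_graph \<Rightarrow> 'v set" where
  "states G = V0 G \<union> V1 G"

definition wf_game_graph :: "('v, 'p) game_graph \<Rightarrow> bool" where
  "wf_game_graph G \<longleftrightarrow>
     finite (states G) \<and> V0 G \<inter> V1 G = {} \<and>
     edges G \<subseteq> states G \<times> states G \<and> (\<forall>v \<in> states G. \<exists>u. (v, u) \<in> edges G) \<and>
     finite (props G) \<and> (\<forall>v \<in> states G. label G v \<subseteq> props G)"

definition plays :: "('v, 'p) game_graph \<Rightarrow> 'v word set" where
  "plays G = {r. \<forall>i. (r i, r (Suc i)) \<in> edges G}"

definition W_game :: "('v, 'p) game_graph \<Rightarrow> 'p ltl \<Rightarrow> 'p set word set" where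
  "W_game G \<phi> = W (props G) \<phi> \<inter> (\<lambda>r. label G \<circ> r) ` plays G"

definition ltl_game :: "('v, 'p) game_graph \<Rightarrow> 'p ltl \<Rightarrow> bool" where
  "ltl_game G \<phi> \<longleftrightarrow> wf_game_graph G \<and> atoms \<phi> \<subseteq> props G"

(* The first argument is the past history, excluding the current state. *)
type_synonym 'v strategy = "'v list \<Rightarrow> 'v \<Rightarrow> 'v option"

definition is_strategy :: "('v, 'p) game_graph \<Rightarrow> 'v strategy \<Rightarrow> bool" where
  "is_strategy G f \<longleftrightarrow>
     (\<forall>h v u. f h v = Some u \<longrightarrow> h \<in> lists (states G) \<and> v \<in> V0 G \<and> (v, u) \<in> edges G)"

(* reached G f v h u: following f from v, the play can be in state u with past history h. *)
inductive reached :: "('v, 'p) game_graph \<Rightarrow> 'v strategy \<Rightarrow> 'v \<Rightarrow> 'v list \<Rightarrow> 'v \<Rightarrow> bool"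
  for G f v where
  start: "reached G f v [] v"
| move0: "reached G f v h u \<Longrightarrow> u \<in> V0 G \<Longrightarrow> f h u = Some u' \<Longrightarrow> reached G f v (h @ [u]) u'"
| move1: "reached G f v h u \<Longrightarrow> u \<in> V1 G \<Longrightarrow> (u, u') \<in> edges G \<Longrightarrow> reached G f v (h @ [u]) u'"

definition follows :: "('v, 'p) game_graph \<Rightarrow> 'v strategy \<Rightarrow> 'v word \<Rightarrow> bool" where
  "follows G f r \<longleftrightarrow> (\<forall>i. r i \<in> V0 G \<longrightarrow> f (prefix i r) (r i) = Some (r (Suc i)))"

definition winning_from :: "('v, 'p) game_graph \<Rightarrow> 'p ltl \<Rightarrow> 'v strategy \<Rightarrow> 'v \<Rightarrow> bool" where
  "winning_from G \<phi> f v \<longleftrightarrow>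
     (\<forall>h u. reached G f v h u \<and> u \<in> V0 G \<longrightarrow> f h u \<noteq> None) \<and>
     (\<forall>r \<in> plays G. r 0 = v \<and> follows G f r \<longrightarrow> label G \<circ> r \<in> W (props G) \<phi>)"

definition winning_set :: "('v, 'p) game_graph \<Rightarrow> 'p ltl \<Rightarrow> 'v set" where
  "winning_set G \<phi> = {v \<in> states G. \<exists>f. is_strategy G f \<and> winning_from G \<phi> f v}"

(* Adds every set Z of states as an atomic proposition Inr Z holding exactly at the states of Z;
   the original propositions p become Inl p. *)
definition with_state_sets :: "('v, 'p) game_graph \<Rightarrow> ('v, 'p + 'v set) game_graph" where
  "with_state_sets G =
     \<lparr> V0 = V0 G, V1 = V1 G, edges = edges G,
       props = Inl ` props G \<union> Inr ` Pow (states G),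
       label = (\<lambda>v. Inl ` label G v \<union> Inr ` {Z. Z \<subseteq> states G \<and> v \<in> Z}) \<rparr>"

abbreviation lift_formula :: "'p ltl \<Rightarrow> ('p + 'v set) ltl" where
  "lift_formula \<equiv> map_ltl Inl"

abbreviation State_set :: "'v set \<Rightarrow> ('p + 'v set) ltl" where
  "State_set Z \<equiv> Atom (Inr Z)"

(* The greatest fixed point of a monotone operator F on the subsets of a finite set V. *)
definition nu :: "'v set \<Rightarrow> ('v set \<Rightarrow> 'v set) \<Rightarrow> 'v set" where
  "nu V F = (\<Inter>i. (F ^^ i) V)"

definition simple_game ::
  "('v, 'p) game_graph \<Rightarrow> 'p ltl \<Rightarrow> 'i set \<Rightarrow> ('i \<Rightarrow> 'p ltl) \<Rightarrow> ('i \<Rightarrow> 'p ltl) \<Rightarrow> bool" where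
  "simple_game G \<phi> I p \<psi> \<longleftrightarrow>
     ltl_game G \<phi> \<and> finite I \<and>
     ltl_equiv (props G) \<phi> (Box (BigAnd I (\<lambda>i. Or (Diamond (p i)) (\<psi> i)))) \<and>
     (\<forall>i\<in>I. atoms (p i) \<subseteq> props G \<and> positional (p i) \<and>
            atoms (\<psi> i) \<subseteq> props G \<and> absolute_liveness (props G) (\<psi> i) \<and>
            W_game G (\<psi> i) \<subseteq> W (props G) \<phi>)"

end

theory Submission
  imports Defs
begin

text \<open>
  For \<open>\<subseteq>\<close>, the winning condition is closed under suffixes, so the residual of a winning strategy
  wins from every state it visits: the winning set is a post-fixed point of the operator.
  For \<open>\<supseteq>\<close>, let \<open>Z\<close> be the fixed point and play the strategies for
  \<open>\<psi>\<^sub>i \<or> \<diamond>(p\<^sub>i \<and> \<circle>Z)\<close> in turn, cyclically in \<open>i\<close>, switching to the next one (from the current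
  state, which is in \<open>Z\<close>) as soon as \<open>p\<^sub>i \<and> \<circle>Z\<close> has been achieved. With infinitely many switches
  every \<open>p\<^sub>i\<close> holds infinitely often; otherwise a suffix of the play satisfies some \<open>\<psi>\<^sub>i\<close>, hence
  the winning condition, which is itself an absolute liveness property.
\<close>

section \<open>Semantics of formulas\<close>

lemma sat_suffix: "sat (suffix k w) i \<phi> \<longleftrightarrow> sat w (k + i) \<phi>"
proof (induction \<phi> arbitrary: i)
  case (Until \<phi> \<psi>)
  show ?case
  proof
    assume "sat (suffix k w) i (Until \<phi> \<psi>)"
    then obtain m where m: "m \<ge> i" "sat w (k + m) \<psi>" "\<forall>j. i \<le> j \<and> j < m \<longrightarrow> sat w (k + j) \<phi>"
      by (auto simp: Until)
    have "sat w j \<phi>" if "k + i \<le> j" "j < k + m" for j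
    proof -
      have "i \<le> j - k" "j - k < m" "k + (j - k) = j" using that by auto
      with m(3) show ?thesis by metis
    qed
    with m(1,2) show "sat w (k + i) (Until \<phi> \<psi>)"
      by (auto intro!: exI[of _ "k + m"])
  next
    assume "sat w (k + i) (Until \<phi> \<psi>)"
    then obtain m where m: "m \<ge> k + i" "sat w m \<psi>" "\<forall>j. k + i \<le> j \<and> j < m \<longrightarrow> sat w j \<phi>"
      by auto
    then show "sat (suffix k w) i (Until \<phi> \<psi>)"
      by (auto simp: Until intro!: exI[of _ "m - k"])
  qed
qed auto

text \<open>Without temporal operators the evaluation never leaves position \<open>i\<close>; the
  constant word encodes the single letter read there.\<close>

lemma sat_positional: "positional \<phi> \<Longrightarrow> sat w i \<phi> \<longleftrightarrow> sat (\<lambda>_. w i) 0 \<phi>"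
  by (induction \<phi>) auto

lemma sat_map_ltl: "sat w i (map_ltl h \<phi>) \<longleftrightarrow> sat (\<lambda>n. h -` w n) i \<phi>"
  by (induction \<phi> arbitrary: i) auto

section \<open>Games with arbitrary winning conditions\<close>

text \<open>Conditions are sets of plays, independent of labels, so that \<open>G\<close> and
  \<open>with_state_sets G\<close>, which have the same plays, can be compared directly.\<close>

definition wins :: "('v, 'p) game_graph \<Rightarrow> 'v word set \<Rightarrow> 'v strategy \<Rightarrow> 'v \<Rightarrow> bool" where
  "wins G S f v \<longleftrightarrow>
     (\<forall>h u. reached G f v h u \<and> u \<in> V0 G \<longrightarrow> f h u \<noteq> None) \<and>
     (\<forall>r \<in> plays G. r 0 = v \<and> follows G f r \<longrightarrow> r \<in> S)"

definition win_region :: "('v, 'p) game_graph \<Rightarrow> 'v word set \<Rightarrow> 'v set" where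
  "win_region G S = {v \<in> states G. \<exists>f. is_strategy G f \<and> wins G S f v}"

lemma win_region_subset_states: "win_region G S \<subseteq> states G"
  by (auto simp: win_region_def)

lemma win_region_mono:
  assumes "\<And>r. r \<in> plays G \<Longrightarrow> r \<in> S \<Longrightarrow> r \<in> S'"
  shows "win_region G S \<subseteq> win_region G S'"
  using assms unfolding win_region_def wins_def by blast

lemma win_region_cong:
  assumes "\<And>r. r \<in> plays G \<Longrightarrow> r \<in> S \<longleftrightarrow> r \<in> S'"
  shows "win_region G S = win_region G S'"
  using assms by (intro equalityI win_region_mono) auto

lemma play_in_states: "wf_game_graph G \<Longrightarrow> r \<in> plays G \<Longrightarrow> r i \<in> states G"
  by (auto simp: wf_game_graph_def plays_def)

lemma range_label_play:
  assumes "wf_game_graph G" "r \<in> plays G"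
  shows "range (label G \<circ> r) \<subseteq> Pow (props G)"
  using play_in_states[OF assms] assms(1) by (auto simp: wf_game_graph_def)

lemma suffix_play: "r \<in> plays G \<Longrightarrow> suffix k r \<in> plays G"
  by (simp add: plays_def)

lemma winning_set_eq_win_region:
  assumes "wf_game_graph G"
  shows "winning_set G \<phi> = win_region G {r. sat (label G \<circ> r) 0 \<phi>}"
  using range_label_play[OF assms]
  by (auto simp: winning_set_def win_region_def winning_from_def wins_def W_def)

section \<open>Reached positions and residuals of strategies\<close>

lemma is_strategy_SomeD:
  "is_strategy G f \<Longrightarrow> f h v = Some u \<Longrightarrow> h \<in> lists (states G) \<and> v \<in> V0 G \<and> (v, u) \<in> edges G"
  by (auto simp: is_strategy_def)

text \<open>A strategy is defined only on histories over \<open>states G\<close>; this shows that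
  such a guard never fails at a reached position.\<close>

lemma reached_in_states:
  assumes "wf_game_graph G" "is_strategy G f" "v \<in> states G" "reached G f v h u"
  shows "h \<in> lists (states G) \<and> u \<in> states G"
  using assms(4)
proof induction
  case (move0 h u u')
  then show ?case
    using assms(1) is_strategy_SomeD[OF assms(2), of h u u'] by (auto simp: wf_game_graph_def)
next
  case (move1 h u u')
  then show ?case
    using assms(1) by (auto simp: wf_game_graph_def)
qed (use assms(3) in auto)

lemma reached_prefix:
  assumes "wf_game_graph G" "r \<in> plays G" "follows G f r"
  shows "reached G f (r 0) (prefix k r) (r k)"
proof (induction k)
  case (Suc k)
  have "r k \<in> V0 G \<or> r k \<in> V1 G"
    using play_in_states[OF assms(1,2)] by (auto simp: states_def)
  moreover have "(r k, r (Suc k)) \<in> edges G"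
    using assms(2) by (simp add: plays_def)
  ultimately show ?case
    using assms(3) reached.move0[OF Suc.IH] reached.move1[OF Suc.IH]
    by (auto simp: follows_def subsequence_def)
qed (simp add: subsequence_def reached.start)

lemma reached_residual:
  assumes "reached G f v h u" "reached G (\<lambda>h'. f (h @ h')) u h' u'"
  shows "reached G f v (h @ h') u'"
  using assms(2)
proof induction
  case (move0 h' u u')
  then show ?case
    using reached.move0[of G f v "h @ h'" u u'] by simp
next
  case (move1 h' u u')
  then show ?case
    using reached.move1[of G f v "h @ h'" u u'] by simp
qed (use assms(1) in simp)

lemma prefix_conc_play:
  assumes "r \<in> plays G" "follows G f r" "r' \<in> plays G" "r' 0 = r k"
    and "follows G (\<lambda>h. f (prefix k r @ h)) r'"
  shows "prefix k r \<frown> r' \<in> plays G" "follows G f (prefix k r \<frown> r')"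
proof -
  let ?q = "prefix k r \<frown> r'"
  \<comment> \<open>The joint \<open>i = k\<close> is included because \<open>r' 0 = r k\<close>, so
    the transition into position \<open>k\<close> is still one of \<open>r\<close>.\<close>
  have low: "?q i = r i" if "i \<le> k" for i
    using that assms(4) by (cases "i = k") (auto simp: conc_def)
  have high: "?q (k + i) = r' i" for i
    by (auto simp: conc_def)
  have plow: "prefix i ?q = prefix i r" if "i \<le> k" for i
    using that low by (auto simp: subsequence_def)
  have phigh: "prefix (k + i) ?q = prefix k r @ prefix i r'" for i
    by (rule nth_equalityI) (auto simp: subsequence_def nth_append conc_def)
  show "?q \<in> plays G"
    unfolding plays_def
  proof (intro CollectI allI)
    fix i
    show "(?q i, ?q (Suc i)) \<in> edges G"
    proof (cases "i < k")
      case True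
      then show ?thesis using low[of i] low[of "Suc i"] assms(1) by (simp add: plays_def)
    next
      case False
      then show ?thesis using high[of "i - k"] high[of "Suc (i - k)"] assms(3)
        by (simp add: plays_def)
    qed
  qed
  show "follows G f ?q"
    unfolding follows_def
  proof (intro allI impI)
    fix i
    assume i: "?q i \<in> V0 G"
    show "f (prefix i ?q) (?q i) = Some (?q (Suc i))"
    proof (cases "i < k")
      case True
      then show ?thesis using i low[of i] low[of "Suc i"] plow[of i] assms(2)
        by (simp add: follows_def)
    next
      case False
      then show ?thesis
        using i high[of "i - k"] high[of "Suc (i - k)"] phigh[of "i - k"] assms(5)
        by (simp add: follows_def)
    qed
  qed
qed

text \<open>A play \<open>q\<close> of the residual strategy from \<open>r k\<close>, preceded by
  \<open>prefix k r\<close>, is a play of \<open>f\<close> from \<open>r 0\<close>, hence in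
  \<open>S\<close>; closure of \<open>S\<close> under suffixes returns \<open>q\<close>.\<close>

lemma win_region_residual:
  assumes wf: "wf_game_graph G"
    and f: "is_strategy G f" "wins G S f (r 0)"
    and r: "r \<in> plays G" "follows G f r"
    and S: "\<And>q. q \<in> plays G \<Longrightarrow> q \<in> S \<Longrightarrow> suffix k q \<in> S"
  shows "r k \<in> win_region G S"
proof -
  let ?f = "\<lambda>h. f (prefix k r @ h)"
  have "is_strategy G ?f"
    unfolding is_strategy_def using is_strategy_SomeD[OF f(1)] by fastforce
  moreover have "wins G S ?f (r k)"
    unfolding wins_def
  proof (intro conjI allI impI ballI; elim conjE)
    fix h u
    assume "reached G ?f (r k) h u" "u \<in> V0 G"
    then show "?f h u \<noteq> None"
      using reached_residual[OF reached_prefix[OF wf r]] f(2) by (auto simp: wins_def)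
  next
    fix q
    assume q: "q \<in> plays G" "q 0 = r k" "follows G ?f q"
    have "(prefix k r \<frown> q) 0 = r 0"
      using q(2) by (cases "k = 0") (auto simp: conc_def)
    then have "prefix k r \<frown> q \<in> S"
      using prefix_conc_play[OF r q] f(2) by (auto simp: wins_def)
    then have "suffix k (prefix k r \<frown> q) \<in> S"
      using S prefix_conc_play(1)[OF r q] by blast
    then show "q \<in> S"
      by (simp add: suffix_conc_length)
  qed
  ultimately show ?thesis
    using play_in_states[OF wf r(1)] by (auto simp: win_region_def)
qed

text \<open>Every state has a successor, so an arbitrary choice of moves is defined wherever it must
  be. This settles the empty conjunction.\<close>

lemma win_region_UNIV:
  assumes "wf_game_graph G"
  shows "win_region G UNIV = states G"
proof -
  define f where "f h v = (if h \<in> lists (states G) \<and> v \<in> V0 G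
    then Some (SOME u. (v, u) \<in> edges G) else None)" for h v
  have "is_strategy G f"
    using assms unfolding is_strategy_def f_def wf_game_graph_def states_def
    by (auto intro: someI_ex)
  moreover from this have "wins G UNIV f v" if "v \<in> states G" for v
    using reached_in_states[OF assms _ that] by (auto simp: wins_def f_def)
  ultimately show ?thesis
    by (auto simp: win_region_def)
qed

section \<open>Switching between strategies\<close>

text \<open>\<open>goal n\<close> is the positional part of the n-th target, and
  \<open>g n s\<close> the strategy for that target started in \<open>s\<close>. Only definedness is
  assumed of these strategies; what their plays achieve enters after the interpretation.\<close>

locale switching =
  fixes G :: "('v, 'p) game_graph"
    and Z :: "'v set"
    and goal :: "nat \<Rightarrow> 'v \<Rightarrow> bool"
    and g :: "nat \<Rightarrow> 'v \<Rightarrow> 'v strategy"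
  assumes wf: "wf_game_graph G"
    and Z_states: "Z \<subseteq> states G"
    and strat: "s \<in> Z \<Longrightarrow> is_strategy G (g n s)"
    and total: "s \<in> Z \<Longrightarrow> reached G (g n s) s h u \<Longrightarrow> u \<in> V0 G \<Longrightarrow> g n s h u \<noteq> None"
begin

text \<open>
  The history is given in reverse. The result consists of the number of switches so far, the state
  in which the last switch took place, and the (unreversed) history since then.
\<close>
primrec mode :: "'v list \<Rightarrow> 'v \<Rightarrow> nat \<times> 'v \<times> 'v list" where
  "mode [] v = (0, v, [])"
| "mode (u # h) v = (case mode h u of (n, s, h') \<Rightarrow>
     if goal n u \<and> v \<in> Z then (Suc n, v, []) else (n, s, h' @ [u]))"

text \<open>The history is reversed because \<open>mode\<close> recurses on the most recent state.
  The two guards make \<open>switch\<close> a legal strategy on all arguments; both hold at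
  positions reached from \<open>Z\<close>.\<close>

definition switch :: "'v strategy" where
  "switch h v = (if h \<in> lists (states G)
     then (case mode (rev h) v of (n, s, h') \<Rightarrow> if s \<in> Z then g n s h' v else None) else None)"

lemma is_strategy_switch: "is_strategy G switch"
  using strat unfolding is_strategy_def switch_def
  by (fastforce split: prod.splits if_splits)

text \<open>Invariant: the strategy in charge has been followed since the last switch. A switch
  restores it trivially, as the new strategy starts with empty history in a state of
  \<open>Z\<close>.\<close>

lemma reached_switch:
  assumes "v \<in> Z" "reached G switch v h u"
  shows "\<exists>n s h'. mode (rev h) u = (n, s, h') \<and> s \<in> Z \<and> reached G (g n s) s h' u"
  using assms(2)
proof induction
  case start
  then show ?case using assms(1) by (auto intro: reached.start)
next
  case (move0 h u u')
  then obtain n s h' where m: "mode (rev h) u = (n, s, h')" "s \<in> Z" "reached G (g n s) s h' u"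
    by blast
  with move0.hyps have "g n s h' u = Some u'"
    by (auto simp: switch_def split: if_splits)
  then show ?case
    using m move0.hyps by (auto intro: reached.intros)
next
  case (move1 h u u')
  then obtain n s h' where m: "mode (rev h) u = (n, s, h')" "s \<in> Z" "reached G (g n s) s h' u"
    by blast
  then show ?case
    using move1.hyps by (auto intro: reached.intros)
qed

lemma switch_total:
  assumes "v \<in> Z" "reached G switch v h u" "u \<in> V0 G"
  shows "switch h u \<noteq> None"
proof -
  have "h \<in> lists (states G)"
    using reached_in_states[OF wf is_strategy_switch _ assms(2)] assms(1) Z_states by blast
  moreover obtain n s h' where
    "mode (rev h) u = (n, s, h')" "s \<in> Z" "reached G (g n s) s h' u"
    using reached_switch[OF assms(1,2)] by blast
  ultimately show ?thesis
    using total[of s n h' u] assms(3) by (simp add: switch_def)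
qed

section \<open>Counting the switches along a play\<close>

context
  fixes r :: "'v word"
  assumes r: "r \<in> plays G" "r 0 \<in> Z" "follows G switch r"
begin

definition mode_at :: "nat \<Rightarrow> nat \<times> 'v \<times> 'v list" where
  "mode_at t = mode (rev (prefix t r)) (r t)"

definition switches :: "nat \<Rightarrow> nat" where
  "switches t = fst (mode_at t)"

lemma mode_at_0: "mode_at 0 = (0, r 0, [])"
  by (simp add: mode_at_def subsequence_def)

lemma mode_at_Suc: "mode_at (Suc t) = (case mode_at t of (n, s, h') \<Rightarrow>
     if goal n (r t) \<and> r (Suc t) \<in> Z then (Suc n, r (Suc t), []) else (n, s, h' @ [r t]))"
  by (simp add: mode_at_def subsequence_def)

lemma switches_Suc: "switches (Suc t) =
    (if goal (switches t) (r t) \<and> r (Suc t) \<in> Z then Suc (switches t) else switches t)"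
  by (simp add: switches_def mode_at_Suc split: prod.splits)

lemma mono_switches: "mono switches"
  by (rule mono_iff_le_Suc[THEN iffD2]) (simp add: switches_Suc)

lemma infinitely_many_switches:
  assumes "\<forall>N. \<exists>t. switches t > N"
  shows "\<exists>n0. \<forall>n\<ge>n0. \<exists>t'\<ge>t. goal n (r t')"
proof (rule exI[of _ "switches t"], intro allI impI)
  fix n
  assume n: "n \<ge> switches t"
  \<comment> \<open>The count grows by at most one per step, so just before it first exceeds
    \<open>n\<close> it equals \<open>n\<close>, and the step that raises it witnesses
    \<open>goal n\<close>.\<close>
  define m where "m = (LEAST m. switches m > n)"
  have m: "switches m > n"
    unfolding m_def using assms by (metis LeastI_ex)
  have "m \<noteq> 0"
    using m by (auto simp: switches_def mode_at_0 intro: ccontr)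
  then obtain t' where t': "m = Suc t'"
    by (cases m) auto
  have "\<not> switches t' > n"
    using not_less_Least[of t' "\<lambda>m. switches m > n"] t' unfolding m_def by simp
  with m t' have "switches t' = n" "goal (switches t') (r t')"
    by (auto simp: switches_Suc split: if_splits)
  then have "goal n (r t')" by simp
  moreover have "t \<le> t'"
  proof (rule ccontr)
    assume "\<not> t \<le> t'"
    then have "switches m \<le> switches t"
      using t' mono_switches by (simp add: monoD)
    with m n show False by simp
  qed
  ultimately show "\<exists>t'\<ge>t. goal n (r t')" by blast
qed

text \<open>A bounded monotone count is eventually constant; from then on a single strategy is in
  charge, and the rest of the play follows it.\<close>

lemma finitely_many_switches:
  assumes "\<forall>t. switches t \<le> N"
  shows "\<exists>n t. r t \<in> Z \<and> follows G (g n (r t)) (suffix t r) \<and>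
    (\<forall>j\<ge>t. \<not> (goal n (r j) \<and> r (Suc j) \<in> Z))"
proof -
  have fin: "finite (range switches)"
    using assms by (auto intro!: finite_subset[of _ "{..N}"])
  define n where "n = Max (range switches)"
  have n_max: "switches t \<le> n" for t
    using fin by (simp add: n_def)
  have "n \<in> range switches"
    unfolding n_def using fin by (intro Max_in) auto
  then have ex: "\<exists>t. switches t = n" by auto
  \<comment> \<open>At the first time with the final count, the mode is fresh: either the play
    starts there or a switch has just occurred. Hence the final strategy starts in
    \<open>r t\<close> with empty history.\<close>
  define t where "t = (LEAST t. switches t = n)"
  have t: "switches t = n"
    unfolding t_def using ex by (rule LeastI_ex)
  have const: "switches j = n" if "j \<ge> t" for j
    using monoD[OF mono_switches that] t n_max[of j] by simp
  have no_goal: "\<not> (goal n (r j) \<and> r (Suc j) \<in> Z)" if "j \<ge> t" for j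
    using const[of j] const[of "Suc j"] that by (auto simp: switches_Suc)
  have "mode_at t = (n, r t, []) \<and> r t \<in> Z"
  proof (cases t)
    case 0
    with t show ?thesis using r(2) by (auto simp: switches_def mode_at_0)
  next
    case (Suc t')
    then have "switches t' \<noteq> n"
      using not_less_Least[of t' "\<lambda>t. switches t = n"] unfolding t_def by simp
    with t Suc show ?thesis
      by (auto simp: switches_def mode_at_Suc split: prod.splits if_splits)
  qed
  then have mode_t: "mode_at t = (n, r t, [])" and Z: "r t \<in> Z" by auto
  have mode_j: "mode_at (t + j) = (n, r t, prefix j (suffix t r))" for j
  proof (induction j)
    case 0
    then show ?case by (simp add: mode_t subsequence_def)
  next
    case (Suc j)
    then show ?case using no_goal[of "t + j"] by (auto simp: mode_at_Suc subsequence_def)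
  qed
  have "follows G (g n (r t)) (suffix t r)"
    unfolding follows_def
  proof (intro allI impI)
    fix j
    assume "suffix t r j \<in> V0 G"
    then have "switch (prefix (t + j) r) (r (t + j)) = Some (r (Suc (t + j)))"
      using r(3) by (simp add: follows_def)
    then show "g n (r t) (prefix j (suffix t r)) (suffix t r j) = Some (suffix t r (Suc j))"
      using mode_j[of j] by (auto simp: switch_def mode_at_def split: if_splits)
  qed
  with Z no_goal show ?thesis by blast
qed

end

end

section \<open>The fixed point characterisation\<close>

text \<open>By monotonicity, \<open>A \<subseteq> X\<close> gives
  \<open>A \<subseteq> F A \<subseteq> F X\<close>, so \<open>A\<close> stays below every
  iterate.\<close>

lemma nu_greatest:
  assumes "mono F" "A \<subseteq> F A" "A \<subseteq> V"
  shows "A \<subseteq> nu V F"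
proof -
  have "A \<subseteq> (F ^^ i) V" for i
  proof (induction i)
    case (Suc i)
    then show ?case using assms(2) monoD[OF assms(1), of A] by auto
  qed (use assms(3) in simp)
  then show ?thesis by (auto simp: nu_def)
qed

lemma nu_subset: "nu V F \<subseteq> V"
  using INF_lower[of 0 UNIV "\<lambda>i. (F ^^ i) V"] by (simp add: nu_def)

lemma nu_fixpoint:
  assumes "mono F" "finite V" "F V \<subseteq> V"
  shows "F (nu V F) = nu V F"
proof -
  let ?A = "\<lambda>i. (F ^^ i) V"
  have "?A (Suc i) \<subseteq> ?A i" for i
  proof (induction i)
    case (Suc i)
    then show ?case using monoD[OF assms(1)] by simp
  qed (use assms(3) in simp)
  then have anti: "?A j \<subseteq> ?A i" if "i \<le> j" for i j
    using that by (rule lift_Suc_antimono_le[of ?A])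
  have fin: "finite (?A i)" for i
    using anti[of 0 i] assms(2) by (auto intro: finite_subset)
  \<comment> \<open>The iterates descend within a finite set, so they are constant from one of least
    cardinality onwards.\<close>
  obtain N where N: "\<And>i. card (?A N) \<le> card (?A i)"
    using ex_has_least_nat[of "\<lambda>_. True" 0 "\<lambda>i. card (?A i)"] by auto
  have eq: "?A j = ?A N" if "N \<le> j" for j
    using card_seteq[OF fin anti[OF that] N] .
  have "nu V F = ?A N"
    unfolding nu_def
  proof (intro equalityI INF_lower INF_greatest)
    show "?A N \<subseteq> ?A i" for i
      using eq[of i] anti[of i N] by (cases "N \<le> i") auto
  qed simp
  moreover have "F (?A N) = ?A N"
    using eq[of "Suc N"] by simp
  ultimately show ?thesis by simp
qed

text \<open>Agreement on subsets of \<open>V\<close> suffices, since the iterates stay there. The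
  restriction matters because only subsets of \<open>states G\<close> become propositions.\<close>

lemma nu_cong:
  assumes "\<And>Z. Z \<subseteq> V \<Longrightarrow> F Z = F' Z" "\<And>Z. F' Z \<subseteq> V"
  shows "nu V F = nu V F'"
proof -
  have "(F ^^ i) V = (F' ^^ i) V \<and> (F' ^^ i) V \<subseteq> V" for i
    by (induction i) (auto simp: assms(1) dest: subsetD[OF assms(2)])
  then show ?thesis by (simp add: nu_def)
qed

text \<open>The theorem on the level of plays: \<open>P i\<close> stands for the positional formula
  and \<open>\<Psi> i\<close> for the liveness formula. The assumption \<open>live\<close> is
  absolute liveness read along plays, and \<open>simple\<close> is the inclusion of the i-th
  liveness condition in the winning condition.\<close>

lemma simple_game_fixpoint:
  fixes G :: "('v, 'p) game_graph" and I :: "'i set"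
    and P :: "'i \<Rightarrow> 'v \<Rightarrow> bool" and \<Psi> :: "'i \<Rightarrow> 'v word \<Rightarrow> bool"
  defines "\<Phi> \<equiv> {r. \<forall>k. \<forall>i\<in>I. (\<exists>m\<ge>k. P i (r m)) \<or> \<Psi> i (suffix k r)}"
    and "F \<equiv> \<lambda>Z. states G \<inter> (\<Inter>i\<in>I. win_region G {r. \<Psi> i r \<or> (\<exists>k. P i (r k) \<and> r (Suc k) \<in> Z)})"
  assumes wf: "wf_game_graph G" and "finite I"
    and live: "\<And>i r k. i \<in> I \<Longrightarrow> r \<in> plays G \<Longrightarrow> \<Psi> i (suffix k r) \<Longrightarrow> \<Psi> i r"
    and simple: "\<And>i r. i \<in> I \<Longrightarrow> r \<in> plays G \<Longrightarrow> \<Psi> i r \<Longrightarrow> r \<in> \<Phi>"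
  shows "win_region G \<Phi> = nu (states G) F"
proof
  have "mono F"
    unfolding F_def by (intro monoI Int_mono INF_mono' win_region_mono) auto
  have suffix_\<Phi>: "suffix k r \<in> \<Phi>" if "r \<in> \<Phi>" for r k
    unfolding \<Phi>_def
  proof (intro CollectI allI ballI)
    fix l i
    assume "i \<in> I"
    with that have "(\<exists>m\<ge>k + l. P i (r m)) \<or> \<Psi> i (suffix (k + l) r)"
      by (auto simp: \<Phi>_def)
    then show "(\<exists>m\<ge>l. P i (suffix k r m)) \<or> \<Psi> i (suffix l (suffix k r))"
    proof
      assume "\<exists>m\<ge>k + l. P i (r m)"
      then obtain m where "m \<ge> k + l" "P i (r m)" by blast
      then show ?thesis by (intro disjI1 exI[of _ "m - k"]) auto
    qed (simp add: suffix_suffix)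
  qed
  \<comment> \<open>The strategy winning for \<open>\<Phi>\<close> also wins this game: position 0
    of \<open>\<Phi>\<close> yields the disjunction, and all states visited lie in the winning
    region by \<open>win_region_residual\<close>.\<close>
  have "v \<in> win_region G {r. \<Psi> i r \<or> (\<exists>k. P i (r k) \<and> r (Suc k) \<in> win_region G \<Phi>)}"
    if v: "v \<in> win_region G \<Phi>" and i: "i \<in> I" for v i
  proof -
    obtain f where f: "is_strategy G f" "wins G \<Phi> f v" and vs: "v \<in> states G"
      using v by (auto simp: win_region_def)
    have "\<Psi> i r \<or> (\<exists>k. P i (r k) \<and> r (Suc k) \<in> win_region G \<Phi>)"
      if r: "r \<in> plays G" "r 0 = v" "follows G f r" for r
    proof -
      have "r \<in> \<Phi>"
        using f(2) r by (auto simp: wins_def)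
      then have "(\<exists>m\<ge>0. P i (r m)) \<or> \<Psi> i (suffix 0 r)"
        using i unfolding \<Phi>_def by blast
      moreover have "r (Suc m) \<in> win_region G \<Phi>" for m
        using win_region_residual[OF wf f(1) _ r(1,3)] f(2) r(2) suffix_\<Phi> by blast
      ultimately show ?thesis by auto
    qed
    with f vs show ?thesis
      by (auto simp: win_region_def wins_def)
  qed
  then have "win_region G \<Phi> \<subseteq> F (win_region G \<Phi>)"
    unfolding F_def by (intro subsetI IntI INT_I subsetD[OF win_region_subset_states])
  then show "win_region G \<Phi> \<subseteq> nu (states G) F"
    by (intro nu_greatest \<open>mono F\<close> win_region_subset_states)

  show "nu (states G) F \<subseteq> win_region G \<Phi>"
  \<comment> \<open>An empty \<open>I\<close> leaves no strategies to cycle through.\<close>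
  proof (cases "I = {}")
    case True
    then have "\<Phi> = UNIV" by (simp add: \<Phi>_def)
    then show ?thesis
      using win_region_UNIV[OF wf] nu_subset by simp
  next
    case False
    define Z where "Z = nu (states G) F"
    have Z_F: "F Z = Z"
      unfolding Z_def using wf by (intro nu_fixpoint \<open>mono F\<close>) (auto simp: F_def wf_game_graph_def)
    have Z_states: "Z \<subseteq> states G"
      by (subst Z_F[symmetric]) (auto simp: F_def)
    let ?S = "\<lambda>i. {r. \<Psi> i r \<or> (\<exists>k. P i (r k) \<and> r (Suc k) \<in> Z)}"
    define g where "g i s = (SOME f. is_strategy G f \<and> wins G (?S i) f s)" for i s
    have g: "is_strategy G (g i s) \<and> wins G (?S i) (g i s) s" if "s \<in> Z" "i \<in> I" for s i
    proof -
      have "s \<in> F Z" using that(1) Z_F by simp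
      then have "s \<in> win_region G (?S i)"
        unfolding F_def using that(2) by (elim IntE INT_E) auto
      then have "\<exists>f. is_strategy G f \<and> wins G (?S i) f s"
        unfolding win_region_def by blast
      then show ?thesis unfolding g_def by (rule someI_ex)
    qed
    obtain e where e: "bij_betw e {0..<card I} I"
      using ex_bij_betw_nat_finite[OF \<open>finite I\<close>] by blast
    have card: "card I > 0"
      using False \<open>finite I\<close> by (simp add: card_gt_0_iff)
    \<comment> \<open>Cyclic enumeration of \<open>I\<close>, in which every index recurs beyond any
      bound.\<close>
    define c where "c n = e (n mod card I)" for n
    have c_I: "c n \<in> I" for n
      using bij_betwE[OF e] card by (simp add: c_def)
    have c_inf: "\<exists>n\<ge>n0. c n = i" if i: "i \<in> I" for n0 i
    proof -
      obtain k where "k < card I" "e k = i"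
        using bij_betw_imp_surj_on[OF e] i by (metis atLeastLessThan_iff imageE)
      \<comment> \<open>Adding \<open>n0\<close> full periods to \<open>k\<close> keeps the residue
        and passes \<open>n0\<close>, as the period is positive.\<close>
      then show ?thesis
        using card by (intro exI[of _ "k + n0 * card I"]) (auto simp: c_def trans_le_add2)
    qed
    interpret switching G Z "\<lambda>n. P (c n)" "\<lambda>n. g (c n)"
    proof
      fix s n h u
      assume "s \<in> Z" "reached G (g (c n) s) s h u" "u \<in> V0 G"
      then show "g (c n) s h u \<noteq> None"
        using g[OF _ c_I] by (auto simp: wins_def)
    qed (use wf Z_states g c_I in auto)
    have "r \<in> \<Phi>" if r: "r \<in> plays G" "r 0 \<in> Z" "follows G switch r" for r
    proof (cases "\<forall>N. \<exists>t. switches r t > N")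
      case True
      have "\<exists>m\<ge>k. P i (r m)" if "i \<in> I" for k i
        using infinitely_many_switches[OF r True, of k] c_inf[OF that] by metis
      then show ?thesis
        by (auto simp: \<Phi>_def)
    next
      case False
      then obtain N where "\<forall>t. switches r t \<le> N"
        by (auto simp: not_less)
      from finitely_many_switches[OF r this] obtain n t where
        t: "r t \<in> Z" "follows G (g (c n) (r t)) (suffix t r)"
          "\<And>j. j \<ge> t \<Longrightarrow> \<not> (P (c n) (r j) \<and> r (Suc j) \<in> Z)"
        by blast
      have "suffix t r 0 = r t" by simp
      \<comment> \<open>The suffix is won by the final strategy, and its reachability alternative
        would have caused another switch; only \<open>\<Psi>\<close> remains.\<close>
      then have "suffix t r \<in> ?S (c n)"
        using g[OF t(1) c_I] suffix_play[OF r(1)] t(2) unfolding wins_def by blast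
      then have "\<Psi> (c n) (suffix t r)"
        using t(3) by auto
      then have suf: "suffix t r \<in> \<Phi>"
        using simple c_I suffix_play[OF r(1)] by blast
      \<comment> \<open>Back from the suffix to \<open>r\<close>: a witness \<open>m\<close> moves
        to \<open>t + m\<close>, still at least \<open>k\<close>, while for \<open>\<Psi>\<close>
        the two suffix operations commute and \<open>live\<close> removes the one by
        \<open>t\<close>.\<close>
      show ?thesis
        unfolding \<Phi>_def
      proof (intro CollectI allI ballI)
        fix k i
        assume i: "i \<in> I"
        with suf have "(\<exists>m\<ge>k. P i (suffix t r m)) \<or> \<Psi> i (suffix k (suffix t r))"
          unfolding \<Phi>_def by blast
        then show "(\<exists>m\<ge>k. P i (r m)) \<or> \<Psi> i (suffix k r)"
        proof
          assume "\<exists>m\<ge>k. P i (suffix t r m)"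
          then show ?thesis by (auto intro: trans_le_add2)
        next
          assume "\<Psi> i (suffix k (suffix t r))"
          then have "\<Psi> i (suffix t (suffix k r))"
            by (simp add: suffix_suffix add.commute)
          then show ?thesis
            using live[OF i suffix_play[OF r(1)]] by blast
        qed
      qed
    qed
    then have "wins G \<Phi> switch v" if "v \<in> Z" for v
      using that switch_total[OF that] by (auto simp: wins_def)
    then show ?thesis
      using is_strategy_switch Z_states unfolding Z_def[symmetric] win_region_def by blast
  qed
qed

section \<open>Adding sets of states as propositions\<close>

lemma with_state_sets_simps [simp]:
  "V0 (with_state_sets G) = V0 G" "V1 (with_state_sets G) = V1 G"
  "edges (with_state_sets G) = edges G"
  "states (with_state_sets G) = states G"
  "plays (with_state_sets G) = plays G"
  "is_strategy (with_state_sets G) = is_strategy G"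
  "follows (with_state_sets G) = follows G"
  by (auto simp: with_state_sets_def states_def plays_def is_strategy_def follows_def fun_eq_iff)

lemma reached_with_state_sets [simp]: "reached (with_state_sets G) f v h u \<longleftrightarrow> reached G f v h u"
proof
  show "reached G f v h u" if "reached (with_state_sets G) f v h u"
    using that by induction (auto intro: reached.intros)
  show "reached (with_state_sets G) f v h u" if "reached G f v h u"
    using that by induction (auto intro: reached.intros)
qed

lemma wf_with_state_sets:
  assumes "wf_game_graph G"
  shows "wf_game_graph (with_state_sets G)"
proof -
  have "finite (props (with_state_sets G))"
    using assms by (simp add: wf_game_graph_def with_state_sets_def)
  moreover have "label (with_state_sets G) v \<subseteq> props (with_state_sets G)" if "v \<in> states G" for v
    using assms that unfolding wf_game_graph_def with_state_sets_def by fastforce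
  ultimately show ?thesis
    using assms by (simp add: wf_game_graph_def)
qed

lemma win_region_with_state_sets: "win_region (with_state_sets G) S = win_region G S"
  by (simp add: win_region_def wins_def)

text \<open>Pulling the extended labels back along \<open>Inl\<close> recovers the original
  labels.\<close>

lemma sat_lift_formula:
  "sat (label (with_state_sets G) \<circ> r) i (lift_formula \<phi>) \<longleftrightarrow> sat (label G \<circ> r) i \<phi>"
proof -
  have "(\<lambda>n. Inl -` (label (with_state_sets G) \<circ> r) n) = label G \<circ> r"
    by (auto simp: with_state_sets_def)
  then show ?thesis by (simp only: sat_map_ltl)
qed

theorem theorem3:
  fixes G :: "('v, 'p) game_graph"
    and \<phi> :: "'p ltl"
    and I :: "'i set"
    and p \<psi> :: "'i \<Rightarrow> 'p ltl"
  assumes "simple_game G \<phi> I p \<psi>"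
  shows "winning_set G \<phi> =
    nu (states G) (\<lambda>Z. states G \<inter> (\<Inter>i\<in>I. winning_set (with_state_sets G)
      (Or (lift_formula (\<psi> i)) (Diamond (And (lift_formula (p i)) (Next (State_set Z)))))))"
proof -
  define P where "P i v = sat (\<lambda>_. label G v) 0 (p i)" for i v
  define \<Psi> where "\<Psi> i r = sat (label G \<circ> r) 0 (\<psi> i)" for i r
  let ?\<Phi> = "{r. \<forall>k. \<forall>i\<in>I. (\<exists>m\<ge>k. P i (r m)) \<or> \<Psi> i (suffix k r)}"
  let ?S = "\<lambda>i Z. {r. \<Psi> i r \<or> (\<exists>k. P i (r k) \<and> r (Suc k) \<in> Z)}"
  have wf: "wf_game_graph G" and "finite I"
    and equiv: "ltl_equiv (props G) \<phi> (Box (BigAnd I (\<lambda>i. Or (Diamond (p i)) (\<psi> i))))"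
    and pos: "\<And>i. i \<in> I \<Longrightarrow> positional (p i)"
    and live: "\<And>i. i \<in> I \<Longrightarrow> absolute_liveness (props G) (\<psi> i)"
    and incl: "\<And>i. i \<in> I \<Longrightarrow> W_game G (\<psi> i) \<subseteq> W (props G) \<phi>"
    using assms by (auto simp: simple_game_def ltl_game_def)
  have sat_p: "sat (label G \<circ> r) k (p i) \<longleftrightarrow> P i (r k)" if "i \<in> I" for r k i
    using sat_positional[OF pos[OF that], of "label G \<circ> r" k] by (simp add: P_def)
  have suffix_comp: "suffix k (label G \<circ> r) = label G \<circ> suffix k r" for k r
    by (simp add: fun_eq_iff)
  have sat_\<psi>: "sat (label G \<circ> r) k (\<psi> i) \<longleftrightarrow> \<Psi> i (suffix k r)" for r k i
    using sat_suffix[of k "label G \<circ> r" 0] by (simp add: \<Psi>_def suffix_comp)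
  have sat_\<phi>: "sat (label G \<circ> r) 0 \<phi> \<longleftrightarrow> r \<in> ?\<Phi>" if r: "r \<in> plays G" for r
  proof -
    have "sat (label G \<circ> r) 0 \<phi> \<longleftrightarrow>
        sat (label G \<circ> r) 0 (Box (BigAnd I (\<lambda>i. Or (Diamond (p i)) (\<psi> i))))"
      using equiv range_label_play[OF wf r] unfolding ltl_equiv_def W_def by blast
    then show ?thesis
      by (simp add: sat_BigAnd[OF \<open>finite I\<close>] sat_p sat_\<psi>)
  qed
  have lhs: "winning_set G \<phi> = win_region G ?\<Phi>"
    unfolding winning_set_eq_win_region[OF wf] by (rule win_region_cong) (use sat_\<phi> in blast)
  have rhs: "winning_set (with_state_sets G)
      (Or (lift_formula (\<psi> i)) (Diamond (And (lift_formula (p i)) (Next (State_set Z))))) =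
      win_region G (?S i Z)" if i: "i \<in> I" and Z: "Z \<subseteq> states G" for i Z
    unfolding winning_set_eq_win_region[OF wf_with_state_sets[OF wf]] win_region_with_state_sets
  proof (rule win_region_cong)
    fix r :: "'v word"
    \<comment> \<open>The bound on \<open>Z\<close> is essential: no state is labelled with a set
      that is not contained in \<open>states G\<close>.\<close>
    have "Inr Z \<in> label (with_state_sets G) v \<longleftrightarrow> v \<in> Z" for v
      using Z by (auto simp: with_state_sets_def)
    then show "r \<in> {r. sat (label (with_state_sets G) \<circ> r) 0
        (Or (lift_formula (\<psi> i)) (Diamond (And (lift_formula (p i)) (Next (State_set Z)))))} \<longleftrightarrow>
        r \<in> ?S i Z"
      by (simp add: sat_lift_formula sat_p[OF i] sat_\<psi>)
  qed
  have "win_region G ?\<Phi> =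
      nu (states G) (\<lambda>Z. states G \<inter> (\<Inter>i\<in>I. win_region G (?S i Z)))"
  proof (rule simple_game_fixpoint[OF wf \<open>finite I\<close>])
    fix i r k
    assume i: "i \<in> I" and r: "r \<in> plays G" and suf: "\<Psi> i (suffix k r)"
    let ?w = "label G \<circ> r"
    have range: "range ?w \<subseteq> Pow (props G)"
      using range_label_play[OF wf r] .
    then have "range (suffix k ?w) \<subseteq> Pow (props G)"
      unfolding suffix_def by blast
    then have "suffix k ?w \<in> W (props G) (\<psi> i)"
      using suf by (simp add: W_def \<Psi>_def suffix_comp)
    moreover have "prefix k ?w \<in> lists (Pow (props G))"
      unfolding subsequence_def using range by (intro in_listsI) (metis ex_map_conv rangeI subsetD)
    \<comment> \<open>Splitting the label word at \<open>k\<close> makes its prefix the finite word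
      that absolute liveness allows to be prepended.\<close>
    ultimately have "prefix k ?w \<frown> suffix k ?w \<in> W (props G) (\<psi> i)"
      using live[OF i] unfolding absolute_liveness_def by blast
    then show "\<Psi> i r"
      by (simp add: W_def \<Psi>_def flip: prefix_suffix)
  next
    fix i r
    assume i: "i \<in> I" and r: "r \<in> plays G" and "\<Psi> i r"
    then have "label G \<circ> r \<in> W_game G (\<psi> i)"
      using range_label_play[OF wf r] by (auto simp: W_game_def W_def \<Psi>_def)
    then have "sat (label G \<circ> r) 0 \<phi>"
      using incl[OF i] by (auto simp: W_def)
    then show "r \<in> ?\<Phi>"
      using sat_\<phi>[OF r] by blast
  qed
  also have "\<dots> = nu (states G) (\<lambda>Z. states G \<inter> (\<Inter>i\<in>I. winning_set (with_state_sets G)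
      (Or (lift_formula (\<psi> i)) (Diamond (And (lift_formula (p i)) (Next (State_set Z)))))))"
    by (rule nu_cong[symmetric]) (auto simp: rhs)
  finally show ?thesis
    unfolding lhs .
qed

end
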